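(* Consider the semi-discrete discontinuous Galerkin scheme for the spherically symmetric Euler--Poisson equations: find $\boldsymbol{u}_h(\cdot,t)=(\rho_h,(\rho u)_h,E_h)^T\in\boldsymbol{\Pi}_h$ such that for all $j=1,\dots,N$ and all test functions $\boldsymbol{v}=(\zeta,\psi,\delta)^T\in\boldsymbol{\Pi}_h$, $$\partial_t\int_{K_j}\boldsymbol{u}_h\cdot\boldsymbol{v}\,r^2\,dr=\mathcal{L}_j(\boldsymbol{u}_h,\boldsymbol{v}):=\mathcal{F}_j(\boldsymbol{u}_h,\boldsymbol{v})+s_j^{[2],\mathrm{wb}}+s_j^{[3]},$$ with $\mathcal{F}_j$, $s_j^{[2],\mathrm{wb}}$, $s_j^{[3]}$ as defined in the context, and with initial value $\boldsymbol{u}_h(\cdot,0)=\boldsymbol{u}_{h,0}:=P\boldsymbol{u}_{ex}$, where $P$ is the Gauss--Radau projection and $\boldsymbol{u}_{ex}$ is the exact initial datum. Then the scheme maintains polytropic hydrostatic equilibria exactly: if $$\boldsymbol{u}_{ex}(r)=\Big(\rho(r),\,0,\,\tfrac{\kappa}{\gamma-1}\rho(r)^\gamma\Big)^T,\qquad r\in[0,R],$$ where $\kappa>0$ and $\rho>0$ is a (regular at the center) solution of $$\frac{1}{r^2}\frac{\partial}{\partial r}\left(\frac{r^2}{\rho}\,\kappa\gamma\rho^{\gamma-1}\frac{\partial\rho}{\partial r}\right)=-4\pi G\rho,$$ then $\mathcal{L}_j(\boldsymbol{u}_{h,0},\boldsymbol{v})=0$ for all $j=1,\dots,N$ and all $\boldsymbol{v}\in\boldsymbol{\Pi}_h$;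 that is, the time-independent function $\boldsymbol{u}_h(\cdot,t)=\boldsymbol{u}_{h,0}$ for all $t\ge 0$ solves the scheme.
   Context: Equations. $\partial_t\boldsymbol{u}+r^{-2}\partial_r(r^2\boldsymbol{f}(\boldsymbol{u}))=\boldsymbol{s}(\boldsymbol{u},\Phi)$ with $\boldsymbol{u}=(\rho,\rho u,E)^T$, $\boldsymbol{f}(\boldsymbol{u})=(\rho u,\rho u^2+p,(E+p)u)^T$, $\boldsymbol{s}=(0,\frac{2p}{r}-\rho\,\partial_r\Phi,-\rho u\,\partial_r\Phi)^T$, ideal equation of state $p=(\gamma-1)(E-\frac12\rho u^2)$ with constant $\gamma>1$, and Poisson equation $r^{-2}\partial_r(r^2\partial_r\Phi)=4\pi G\rho$ with constant $G>0$. Superscripts $[i]$ denote the $i$-th component of a vector. From a numerical state $\boldsymbol{u}_h$, $u_h=(\rho u)_h/\rho_h$ and $p_h=(\gamma-1)(E_h-\frac12\rho_hu_h^2)$. It is understood that all states at which velocity, pressure, sound speed $c=\sqrt{\gamma p/\rho}$ or fluxes are evaluated have positive density (and positive pressure where $c$ is used). Mesh and spaces. $\Omega=[0,R]$ is partitioned into cells $K_j=[r_{j-1/2},r_{j+1/2}]$, $j=1,\dots,N$, $r_{1/2}=0$, $r_{N+1/2}=R$. Fix $k\ge1$; $\mathcal{V}_h=\{v\in L^2(\Omega): v|_{K_j}\in P^k(K_j)\ \forall j\}$ ($P^k$: polynomials of degree at most $k$), $\boldsymbol{\Pi}_h=\mathcal{V}_h^3$. Left and right limits at $r_{j+1/2}$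 are denoted by $\psi^-_{j+1/2}$, $\psi^+_{j+1/2}$. Gauss--Radau projection. For a function $u$, $Pu\in\mathcal{V}_h$ is defined on every cell by $\int_{K_j}Pu\,\psi\,dr=\int_{K_j}u\,\psi\,dr$ for all $\psi\in P^{k-1}(K_j)$ and $Pu(r_{j-1/2}^+)=u(r_{j-1/2}^+)$; it acts componentwise on vectors. Gravitational field. For a density $\rho_h\in\mathcal{V}_h$, $\frac{\partial\Phi_h}{\partial r}(r)=\frac{4\pi G}{r^2}\int_0^r\rho_h\tau^2\,d\tau$, with $\frac{\partial\Phi_h}{\partial r}(0)=0$. Lane--Emden function. With $n=1/(\gamma-1)$, $\theta_n$ is the exact solution of $\xi^{-2}\partial_\xi(\xi^2\partial_\xi\theta)=-\theta^n$, $\theta(0)=1$, $\theta'(0)=0$. Equilibrium recovery. Given $\boldsymbol{u}_h$, let $\rho_0,p_0$ be the density and pressure of $\boldsymbol{u}_h$ at $r=0$ (limit from the right), $\kappa_0=p_0/\rho_0^\gamma$, $\alpha=\sqrt{\frac{\gamma}{\gamma-1}\kappa_0\rho_0^{\gamma-2}/(4\pi G)}$, and $$\boldsymbol{u}^d(r)=\Big(\rho_0\,\theta_n(r/\alpha)^{1/(\gamma-1)},\;0,\;\tfrac{\kappa_0}{\gamma-1}\rho_0^\gamma\,\theta_n(r/\alpha)^{\gamma/(\gamma-1)}\Big)^T,$$ with density $\rho^d$ and pressure $p^d=\kappa_0(\rho^d)^\gamma$. Set $\boldsymbol{u}_h^e=P\boldsymbol{u}^d$ (with density $\rho_h^e$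 and pressure $p_h^e$ computed from $\boldsymbol{u}_h^e$), $\boldsymbol{u}_h^f=\boldsymbol{u}_h-\boldsymbol{u}_h^e$, and $\frac{\partial\Phi_h^e}{\partial r}=\frac{4\pi G}{r^2}\int_0^r\rho_h^e\tau^2\,d\tau$. The recovery is assumed well defined, i.e. $\theta_n(r/\alpha)$ is defined and positive on $[0,R]$. Numerical flux. $\hat{\boldsymbol{f}}^*_{j+1/2}=\hat{\boldsymbol{f}}(\boldsymbol{u}^{*,-}_{h,j+1/2},\boldsymbol{u}^{*,+}_{h,j+1/2})$, where $\boldsymbol{u}^{*,\pm}_{h,j+1/2}=\boldsymbol{u}^d(r_{j+1/2})+\boldsymbol{u}^{f,\pm}_{h,j+1/2}$. At the outer boundary the exterior value is taken equal to the interior one, $\boldsymbol{u}_{h,N+1/2}^{*,+}=\boldsymbol{u}_{h,N+1/2}^{*,-}$; at $r=0$ the flux (reflecting boundary) is multiplied by $r^2=0$ and does not contribute. $\hat{\boldsymbol{f}}$ is the HLLC flux $$\hat{\boldsymbol{f}}(\boldsymbol{u}^-,\boldsymbol{u}^+)=\begin{cases}\boldsymbol{f}(\boldsymbol{u}^-)&0\le S^-,\\ \boldsymbol{f}(\boldsymbol{u}^-)+S^-(\boldsymbol{u}_*^--\boldsymbol{u}^-)&S^-\le0\le S^*,\\ \boldsymbol{f}(\boldsymbol{u}^+)+S^+(\boldsymbol{u}_*^+-\boldsymbol{u}^+)&S^*\le0\le S^+,\\ \boldsymbol{f}(\boldsymbol{u}^+)&0\ge S^+,\end{cases}$$ with $S^-=\min\{u^--c^-,u^+-c^+\}$,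 $S^+=\max\{u^-+c^-,u^++c^+\}$, $S^*=\frac{p^+-p^-+\rho^-u^-(S^--u^-)-\rho^+u^+(S^+-u^+)}{\rho^-(S^--u^-)-\rho^+(S^+-u^+)}$ and $$\boldsymbol{u}_*^\pm=\rho^\pm\frac{S^\pm-u^\pm}{S^\pm-S^*}\Big(1,\;S^*,\;\tfrac{E^\pm}{\rho^\pm}+(S^*-u^\pm)\big(S^*+\tfrac{p^\pm}{\rho^\pm(S^\pm-u^\pm)}\big)\Big)^T.$$ Scheme operators. For $\boldsymbol{v}=(\zeta,\psi,\delta)^T$, $$\mathcal{F}_j(\boldsymbol{u}_h,\boldsymbol{v})=-r_{j+1/2}^2\hat{\boldsymbol{f}}^*_{j+1/2}\cdot\boldsymbol{v}^-_{j+1/2}+r_{j-1/2}^2\hat{\boldsymbol{f}}^*_{j-1/2}\cdot\boldsymbol{v}^+_{j-1/2}+\int_{K_j}\boldsymbol{f}(\boldsymbol{u}_h)\cdot(\partial_r\boldsymbol{v})\,r^2dr,$$ $$s_j^{[3]}=-\int_{K_j}(\rho u)_h\frac{\partial\Phi_h}{\partial r}\delta\,r^2dr,\qquad s_j^{[2],\mathrm{wb}}=\int_{K_j}\Big(\frac{2p_h}{r}-\rho_h\frac{\partial\Phi_h}{\partial r}\Big)\psi\,r^2dr+s_j^{[2],\mathrm{cor}},$$ $$s_j^{[2],\mathrm{cor}}=r_{j+1/2}^2p^d(r_{j+1/2})\psi^-_{j+1/2}-r_{j-1/2}^2p^d(r_{j-1/2})\psi^+_{j-1/2}-\int_{K_j}p_h^e(\partial_r\psi)r^2dr-\int_{K_j}\Big(\frac{2p_h^e}{r}-\rho_h^e\frac{\partial\Phi_h^e}{\partial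 r}\Big)\psi\,r^2dr.$$ "Regular at the center" for the equilibrium density means $\rho$ is twice continuously differentiable on $[0,R]$ with $\rho'(0)=0$. *)

theory Defs
  imports "HOL-Analysis.Analysis" "HOL-Computational_Algebra.Polynomial"
begin

type_synonym state = "real ^ 3"

text \<open>
  A piecewise polynomial is stored as the sequence of its restrictions to the cells: \<open>w j\<close> is the
  polynomial on the \<open>j\<close>-th cell. A function that is two-valued at the cell interfaces is thus
  represented without choosing a value there; its one-sided limits at the endpoints of cell \<open>j\<close>
  are the endpoint values of \<open>w j\<close>.
\<close>

type_synonym pw_poly = "nat \<Rightarrow> real poly"
type_synonym pw_poly3 = "nat \<Rightarrow> (real poly) ^ 3"

definition pw_comp :: "pw_poly3 \<Rightarrow> 3 \<Rightarrow> pw_poly"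
  where "pw_comp v i = (\<lambda>j. v j $ i)"

definition pw_val :: "pw_poly3 \<Rightarrow> nat \<Rightarrow> real \<Rightarrow> state"
  where "pw_val v j x = (\<chi> i. poly (v j $ i) x)"

definition pw_deriv :: "pw_poly3 \<Rightarrow> nat \<Rightarrow> real \<Rightarrow> state"
  where "pw_deriv v j x = (\<chi> i. poly (pderiv (v j $ i)) x)"


subsection \<open>Lane--Emden function\<close>

text \<open>
  \<open>lane_emden_on n L \<theta>\<close>: \<open>\<theta>\<close> solves the Lane--Emden initial value problem with index \<open>n\<close> on
  \<open>[0, L]\<close> and is positive there. Only the range up to the first zero is covered: this is all that
  the equilibrium recovery uses, and \<open>\<theta>\<^sup>n\<close> need not make sense beyond it.
\<close>

definition lane_emden_on :: "real \<Rightarrow> real \<Rightarrow> (real \<Rightarrow> real) \<Rightarrow> bool"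
  where "lane_emden_on n L \<theta> \<longleftrightarrow>
    (\<forall>\<xi>\<in>{0..L}. 0 < \<theta> \<xi>) \<and> \<theta> 0 = 1 \<and>
    (\<exists>\<theta>'. continuous_on {0..L} \<theta>' \<and> \<theta>' 0 = 0 \<and>
      (\<forall>\<xi>\<in>{0..L}. (\<theta> has_real_derivative \<theta>' \<xi>) (at \<xi> within {0..L})) \<and>
      (\<forall>\<xi>\<in>{0<..L}. \<exists>D. ((\<lambda>s. s\<^sup>2 * \<theta>' s) has_real_derivative D) (at \<xi> within {0..L}) \<and>
         1 / \<xi>\<^sup>2 * D = - (\<theta> \<xi> powr n)))"

text \<open>
  The value at \<open>\<xi>\<close> of the solution on \<open>[0, \<xi>]\<close>, which is unique. This is unspecified if there is no
  positive solution up to \<open>\<xi>\<close>.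
\<close>

definition lane_emden :: "real \<Rightarrow> real \<Rightarrow> real"
  where "lane_emden n \<xi> = (THE y. \<exists>\<theta>. lane_emden_on n \<xi> \<theta> \<and> y = \<theta> \<xi>)"


subsection \<open>Polytropic hydrostatic equilibria\<close>

definition polytropic_equilibrium ::
    "real \<Rightarrow> real \<Rightarrow> real \<Rightarrow> real \<Rightarrow> (real \<Rightarrow> real) \<Rightarrow> bool"
  where "polytropic_equilibrium R \<gamma> G \<kappa> \<rho> \<longleftrightarrow>
    (\<forall>x\<in>{0..R}. 0 < \<rho> x) \<and>
    (\<exists>\<rho>' \<rho>''.
      (\<forall>x\<in>{0..R}. (\<rho> has_real_derivative \<rho>' x) (at x within {0..R})) \<and>
      (\<forall>x\<in>{0..R}. (\<rho>' has_real_derivative \<rho>'' x) (at x within {0..R})) \<and>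
      continuous_on {0..R} \<rho>'' \<and> \<rho>' 0 = 0 \<and>
      (\<forall>x\<in>{0<..R}. \<exists>D.
         ((\<lambda>s. s\<^sup>2 / \<rho> s * (\<kappa> * \<gamma> * \<rho> s powr (\<gamma> - 1) * \<rho>' s)) has_real_derivative D)
           (at x within {0..R}) \<and>
         1 / x\<^sup>2 * D = - (4 * pi * G * \<rho> x)))"


subsection \<open>The scheme\<close>

text \<open>
  The mesh is given by its nodes: \<open>r j\<close> stands for \<open>r\<^bsub>j+1/2\<^esub>\<close>, so the \<open>j\<close>-th cell is
  \<open>[r (j - 1), r j]\<close> for \<open>j = 1, \<dots>, N\<close>. Interfaces are numbered \<open>0, \<dots>, N\<close> in the same way.
\<close>

locale euler_poisson_dg =
  fixes R :: real and N :: nat and r :: "nat \<Rightarrow> real" and k :: nat and \<gamma> G :: real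
  assumes N_pos: "1 \<le> N"
    and mesh_left: "r 0 = 0"
    and mesh_right: "r N = R"
    and mesh_less: "\<And>j. j < N \<Longrightarrow> r j < r (Suc j)"
    and k_pos: "1 \<le> k"
    and gamma_gt_1: "1 < \<gamma>"
    and G_pos: "0 < G"
begin

definition cell :: "nat \<Rightarrow> real set"
  where "cell j = {r (j - 1)..r j}"

text \<open>Cells with index outside \<open>1, \<dots>, N\<close> do not exist; the entries there are fixed to be zero.\<close>

definition dg_space :: "pw_poly set"
  where "dg_space = {w. (\<forall>j\<in>{1..N}. degree (w j) \<le> k) \<and> (\<forall>j. j \<notin> {1..N} \<longrightarrow> w j = 0)}"

definition dg_space3 :: "pw_poly3 set"
  where "dg_space3 = {v. \<forall>i. pw_comp v i \<in> dg_space}"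

text \<open>The function on \<open>[0, R]\<close> represented by \<open>w\<close>; at an interior node it takes the left limit.\<close>

definition pw_fun :: "pw_poly \<Rightarrow> real \<Rightarrow> real"
  where "pw_fun w x = poly (w (LEAST j. 1 \<le> j \<and> x \<le> r j)) x"

definition gauss_radau :: "(real \<Rightarrow> real) \<Rightarrow> pw_poly"
  where "gauss_radau g j =
    (if j \<in> {1..N} then
       (THE q. degree q \<le> k \<and>
          (\<forall>\<psi>. degree \<psi> \<le> k - 1 \<longrightarrow>
             integral (cell j) (\<lambda>x. poly q x * poly \<psi> x) =
             integral (cell j) (\<lambda>x. g x * poly \<psi> x)) \<and>
          poly q (r (j - 1)) = Lim (at_right (r (j - 1))) g)
     else 0)"

definition gauss_radau3 :: "(real \<Rightarrow> state) \<Rightarrow> pw_poly3"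
  where "gauss_radau3 g j = (\<chi> i. gauss_radau (\<lambda>x. g x $ i) j)"

definition velocity :: "state \<Rightarrow> real"
  where "velocity s = s $ 2 / s $ 1"

definition pressure :: "state \<Rightarrow> real"
  where "pressure s = (\<gamma> - 1) * (s $ 3 - 1 / 2 * s $ 1 * (velocity s)\<^sup>2)"

definition sound_speed :: "state \<Rightarrow> real"
  where "sound_speed s = sqrt (\<gamma> * pressure s / s $ 1)"

definition flux :: "state \<Rightarrow> state"
  where "flux s = vector [s $ 2, s $ 1 * (velocity s)\<^sup>2 + pressure s,
                          (s $ 3 + pressure s) * velocity s]"

text \<open>
  \<open>hllc_star s S Sc\<close> is the intermediate state next to \<open>s\<close>, for an outer wave of speed \<open>S\<close> and a
  contact wave of speed \<open>Sc\<close>.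
\<close>

definition hllc_star :: "state \<Rightarrow> real \<Rightarrow> real \<Rightarrow> state"
  where "hllc_star s S Sc =
    (s $ 1 * ((S - velocity s) / (S - Sc))) *\<^sub>R
      vector [1, Sc,
        s $ 3 / s $ 1 + (Sc - velocity s) * (Sc + pressure s / (s $ 1 * (S - velocity s)))]"

definition hllc :: "state \<Rightarrow> state \<Rightarrow> state"
  where "hllc a b =
   (let Sm = min (velocity a - sound_speed a) (velocity b - sound_speed b);
        Sp = max (velocity a + sound_speed a) (velocity b + sound_speed b);
        Sc = (pressure b - pressure a + a $ 1 * velocity a * (Sm - velocity a)
                - b $ 1 * velocity b * (Sp - velocity b))
             / (a $ 1 * (Sm - velocity a) - b $ 1 * (Sp - velocity b))
    in if 0 \<le> Sm then flux a
       else if Sm \<le> 0 \<and> 0 \<le> Sc then flux a + Sm *\<^sub>R (hllc_star a Sm Sc - a)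
       else if Sc \<le> 0 \<and> 0 \<le> Sp then flux b + Sp *\<^sub>R (hllc_star b Sp Sc - b)
       else flux b)"

definition grav :: "pw_poly \<Rightarrow> real \<Rightarrow> real"
  where "grav w x = (if x = 0 then 0
    else 4 * pi * G / x\<^sup>2 * integral {0..x} (\<lambda>\<tau>. pw_fun w \<tau> * \<tau>\<^sup>2))"

definition rho0 :: "pw_poly3 \<Rightarrow> real"
  where "rho0 u = pw_val u 1 0 $ 1"

definition p0 :: "pw_poly3 \<Rightarrow> real"
  where "p0 u = pressure (pw_val u 1 0)"

definition kappa0 :: "pw_poly3 \<Rightarrow> real"
  where "kappa0 u = p0 u / rho0 u powr \<gamma>"

definition alpha :: "pw_poly3 \<Rightarrow> real"
  where "alpha u =
    sqrt (\<gamma> / (\<gamma> - 1) * kappa0 u * rho0 u powr (\<gamma> - 2) / (4 * pi * G))"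

definition recovery_well_defined :: "pw_poly3 \<Rightarrow> bool"
  where "recovery_well_defined u \<longleftrightarrow>
    0 < rho0 u \<and> 0 < p0 u \<and> (\<exists>\<theta>. lane_emden_on (1 / (\<gamma> - 1)) (R / alpha u) \<theta>)"

definition ud :: "pw_poly3 \<Rightarrow> real \<Rightarrow> state"
  where "ud u x =
    (let \<theta> = lane_emden (1 / (\<gamma> - 1)) (x / alpha u)
     in vector [rho0 u * \<theta> powr (1 / (\<gamma> - 1)), 0,
                kappa0 u / (\<gamma> - 1) * rho0 u powr \<gamma> * \<theta> powr (\<gamma> / (\<gamma> - 1))])"

definition pd :: "pw_poly3 \<Rightarrow> real \<Rightarrow> real"
  where "pd u x = kappa0 u * (ud u x $ 1) powr \<gamma>"

definition ue :: "pw_poly3 \<Rightarrow> pw_poly3"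
  where "ue u = gauss_radau3 (ud u)"

definition uf :: "pw_poly3 \<Rightarrow> pw_poly3"
  where "uf u j = u j - ue u j"

text \<open>
  \<open>trace_left u j\<close> and \<open>trace_right u j\<close> are the modified states at interface \<open>j\<close> computed from the
  cell to the left (\<open>1 \<le> j\<close>) and to the right (\<open>j < N\<close>) of it. The states entering the flux
  are completed at the two boundaries, by reflection at the center and by copying the interior value
  at \<open>R\<close>. The choice at the center has no influence, as the flux there is multiplied by \<open>0\<close>.
\<close>

definition trace_left :: "pw_poly3 \<Rightarrow> nat \<Rightarrow> state"
  where "trace_left u j = ud u (r j) + pw_val (uf u) j (r j)"

definition trace_right :: "pw_poly3 \<Rightarrow> nat \<Rightarrow> state"
  where "trace_right u j = ud u (r j) + pw_val (uf u) (j + 1) (r j)"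

definition reflect :: "state \<Rightarrow> state"
  where "reflect s = vector [s $ 1, - s $ 2, s $ 3]"

definition ustar_minus :: "pw_poly3 \<Rightarrow> nat \<Rightarrow> state"
  where "ustar_minus u j = (if j = 0 then reflect (trace_right u 0) else trace_left u j)"

definition ustar_plus :: "pw_poly3 \<Rightarrow> nat \<Rightarrow> state"
  where "ustar_plus u j = (if j = N then trace_left u N else trace_right u j)"

definition num_flux :: "pw_poly3 \<Rightarrow> nat \<Rightarrow> state"
  where "num_flux u j = hllc (ustar_minus u j) (ustar_plus u j)"

definition flux_op :: "nat \<Rightarrow> pw_poly3 \<Rightarrow> pw_poly3 \<Rightarrow> real"
  where "flux_op j u v =
    - ((r j)\<^sup>2 * (num_flux u j \<bullet> pw_val v j (r j)))
    + (r (j - 1))\<^sup>2 * (num_flux u (j - 1) \<bullet> pw_val v j (r (j - 1)))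
    + integral (cell j) (\<lambda>x. (flux (pw_val u j x) \<bullet> pw_deriv v j x) * x\<^sup>2)"

definition momentum_source :: "nat \<Rightarrow> pw_poly3 \<Rightarrow> pw_poly3 \<Rightarrow> real"
  where "momentum_source j u v =
    integral (cell j) (\<lambda>x.
      (2 * pressure (pw_val u j x) / x - pw_val u j x $ 1 * grav (pw_comp u 1) x)
        * pw_val v j x $ 2 * x\<^sup>2)"

definition source2_cor :: "nat \<Rightarrow> pw_poly3 \<Rightarrow> pw_poly3 \<Rightarrow> real"
  where "source2_cor j u v =
    (r j)\<^sup>2 * pd u (r j) * pw_val v j (r j) $ 2
    - (r (j - 1))\<^sup>2 * pd u (r (j - 1)) * pw_val v j (r (j - 1)) $ 2
    - integral (cell j) (\<lambda>x. pressure (pw_val (ue u) j x) * pw_deriv v j x $ 2 * x\<^sup>2)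
    - momentum_source j (ue u) v"

definition source2_wb :: "nat \<Rightarrow> pw_poly3 \<Rightarrow> pw_poly3 \<Rightarrow> real"
  where "source2_wb j u v = momentum_source j u v + source2_cor j u v"

definition source3 :: "nat \<Rightarrow> pw_poly3 \<Rightarrow> pw_poly3 \<Rightarrow> real"
  where "source3 j u v =
    - integral (cell j) (\<lambda>x.
        pw_val u j x $ 2 * grav (pw_comp u 1) x * pw_val v j x $ 3 * x\<^sup>2)"

definition dg_rhs :: "nat \<Rightarrow> pw_poly3 \<Rightarrow> pw_poly3 \<Rightarrow> real"
  where "dg_rhs j u v = flux_op j u v + source2_wb j u v + source3 j u v"

definition positive_density :: "pw_poly3 \<Rightarrow> bool"
  where "positive_density u \<longleftrightarrow> (\<forall>j\<in>{1..N}. \<forall>x\<in>cell j. 0 < pw_val u j x $ 1)"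

text \<open>All velocities, pressures, sound speeds and fluxes occurring in the scheme are meaningful.\<close>

definition admissible :: "pw_poly3 \<Rightarrow> bool"
  where "admissible u \<longleftrightarrow>
    positive_density u \<and> recovery_well_defined u \<and> positive_density (ue u) \<and>
    (\<forall>j\<le>N. \<forall>s\<in>{ustar_minus u j, ustar_plus u j}. 0 < s $ 1 \<and> 0 < pressure s)"

definition dg_solution :: "(real \<Rightarrow> state) \<Rightarrow> (real \<Rightarrow> pw_poly3) \<Rightarrow> bool"
  where "dg_solution u_init u \<longleftrightarrow>
    u 0 = gauss_radau3 u_init \<and>
    (\<forall>t\<ge>0. u t \<in> dg_space3 \<and> admissible (u t) \<and>
      (\<forall>j\<in>{1..N}. \<forall>v\<in>dg_space3.
        ((\<lambda>\<tau>. integral (cell j) (\<lambda>x. (pw_val (u \<tau>) j x \<bullet> pw_val v j x) * x\<^sup>2))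
          has_real_derivative dg_rhs j (u t) v) (at t within {0..})))"

end

end

theory Submission
  imports Defs
begin

text \<open>
  The equilibrium equation is the Lane--Emden equation in disguise: \<open>(\<rho> / \<rho> 0) powr (\<gamma> - 1)\<close>, read in
  the variable \<open>\<xi> = x / \<alpha>\<close>, solves the Lane--Emden initial value problem with index \<open>1 / (\<gamma> - 1)\<close>
  (\<open>polytropic_equilibrium_imp_lane_emden_on\<close>). That problem has only one positive solution
  (\<open>lane_emden_on_unique\<close>). The Gauss--Radau projection is exact at the left end of each cell, so
  the projected initial datum has the exact central density and pressure, and the recovery finds the
  exact \<open>\<kappa>\<close> and \<open>\<alpha>\<close>. Hence the recovered equilibrium \<open>u\<^sup>d\<close> equals the exact datum on
  \<open>[0, R]\<close> (\<open>equilibrium_recovery\<close>), its projection \<open>u\<^sup>e\<close> is the numerical state itself, and the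
  fluctuation \<open>u\<^sup>f\<close> vanishes.

  It follows that both modified traces at an interface are the same state at rest. The HLLC flux is
  consistent there and reduces to the pressure \<open>p\<^sup>d\<close> in the momentum component
  (\<open>hllc_rest_state\<close>). The momentum density vanishes identically, so only the momentum equation has
  non-zero terms. There the source terms of \<open>u\<^sub>h\<close> and \<open>u\<^sup>e\<close> cancel, the boundary pressures in the
  correction cancel the numerical fluxes, and its volume pressure integral cancels the flux
  integral (\<open>dg_rhs_equilibrium\<close>). The integrals that cancel have
  identical integrands.

  That the projected datum belongs to the finite element space, and that its central values are
  those of the datum, needs existence and uniqueness of the Gauss--Radau projection
  (\<open>gauss_radau_ex1\<close>).
\<close>


section \<open>Existence and uniqueness of the Gauss--Radau projection\<close>

text \<open>
  The Riesz representation of a linear functional on the polynomials of degree less than \<open>n\<close> with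
  respect to an inner product \<open>B\<close>. The degree bound is expressed by vanishing coefficients, so that
  \<open>n = 0\<close> gives the zero space. The induction is Gram--Schmidt orthogonalization.
\<close>

lemma poly_riesz:
  fixes B :: "real poly \<Rightarrow> real poly \<Rightarrow> real" and F :: "real poly \<Rightarrow> real"
  assumes sym: "\<And>p q. B p q = B q p"
    and add: "\<And>p q s. B (p + q) s = B p s + B q s"
    and smult: "\<And>c p s. B (smult c p) s = c * B p s"
    and pos: "\<And>p. p \<noteq> 0 \<Longrightarrow> 0 < B p p"
    and "\<And>p q. F (p + q) = F p + F q"
    and "\<And>c p. F (smult c p) = c * F p"
  shows "\<exists>h. (\<forall>i\<ge>n. coeff h i = 0) \<and> (\<forall>\<psi>. (\<forall>i\<ge>n. coeff \<psi> i = 0) \<longrightarrow> B h \<psi> = F \<psi>)"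
  using assms(5,6)
proof (induction n arbitrary: F)
  case 0
  have z: "\<psi> = 0" if "\<forall>i\<ge>0. coeff \<psi> i = 0" for \<psi> :: "real poly"
    using that by (simp add: poly_eq_iff)
  have "F 0 = 0" using "0"(2)[of 0 0] by simp
  moreover have "B 0 0 = 0" using smult[of 0 0 0] by simp
  ultimately have "B 0 \<psi> = F \<psi>" if "\<forall>i\<ge>0. coeff \<psi> i = 0" for \<psi>
    using z[OF that] by simp
  then show ?case by (intro exI[of _ 0]) simp
next
  case (Suc n)
  obtain h where h: "\<forall>i\<ge>n. coeff h i = 0"
    "\<And>\<psi>. \<forall>i\<ge>n. coeff \<psi> i = 0 \<Longrightarrow> B h \<psi> = F \<psi>"
    using Suc.IH[OF Suc.prems] by blast
  have add2: "B s (p + q) = B s p + B s q" and smult2: "B s (smult c p) = c * B s p" for s p q c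
    using add smult sym by metis+
  obtain p where p: "\<forall>i\<ge>n. coeff p i = 0"
    "\<And>\<psi>. \<forall>i\<ge>n. coeff \<psi> i = 0 \<Longrightarrow> B p \<psi> = B (monom 1 n) \<psi>"
    using Suc.IH[of "B (monom 1 n)"] add2 smult2 by blast
  \<comment> \<open>\<open>p\<close> is the orthogonal projection of the new monomial, represented by the induction hypothesis\<close>
  define e where "e = monom 1 n + smult (-1) p"
  have e_coeff: "coeff e n = 1" "\<And>i. i > n \<Longrightarrow> coeff e i = 0" using p(1) by (auto simp: e_def)
  have e_orth: "B e \<psi> = 0" if "\<forall>i\<ge>n. coeff \<psi> i = 0" for \<psi>
    using p(2)[OF that] by (simp only: e_def add smult)
  have "e \<noteq> 0" using e_coeff by auto
  then have epos: "0 < B e e" by (rule pos)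
  define h' where "h' = h + smult (F e / B e e) e"
  show ?case
  proof (intro exI[of _ h'] conjI allI impI)
    fix i assume "Suc n \<le> i"
    then show "coeff h' i = 0" using h(1) e_coeff by (simp add: h'_def)
  next
    fix \<psi> :: "real poly" assume \<psi>: "\<forall>i\<ge>Suc n. coeff \<psi> i = 0"
    define c where "c = coeff \<psi> n"
    define \<phi> where "\<phi> = \<psi> + smult (- c) e"
    have \<phi>: "\<forall>i\<ge>n. coeff \<phi> i = 0"
    proof (intro allI impI)
      fix i assume "n \<le> i"
      then show "coeff \<phi> i = 0" using \<psi> e_coeff
        by (cases "i = n") (auto simp: \<phi>_def c_def)
    qed
    have \<psi>_eq: "\<psi> = \<phi> + smult c e" by (simp add: \<phi>_def)
    have "B h e = 0" using e_orth h(1) sym by metis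
    then have "B h' \<psi> = B h \<phi> + F e * c"
      using e_orth[OF \<phi>] epos by (simp only: \<psi>_eq h'_def add add2 smult smult2) simp
    also have "\<dots> = F \<psi>" using h(2)[OF \<phi>] by (simp only: \<psi>_eq Suc.prems) simp
    finally show "B h' \<psi> = F \<psi>" .
  qed
qed

lemma weighted_square_integral_pos:
  fixes a b :: real and p :: "real poly"
  assumes "a < b" "p \<noteq> 0"
  shows "0 < integral {a..b} (\<lambda>x. (x - a) * poly p x * poly p x)"
proof -
  let ?f = "\<lambda>x. (x - a) * poly p x * poly p x"
  have cont: "continuous_on {a..b} ?f" by (intro continuous_intros)
  have nonneg: "0 \<le> ?f x" if "x \<in> {a..b}" for x
    using that by (simp add: mult.assoc)
  have ge: "0 \<le> integral {a..b} ?f"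
    by (rule integral_nonneg) (use cont nonneg integrable_continuous_interval in auto)
  have "integral {a..b} ?f \<noteq> 0"
  proof
    assume "integral {a..b} ?f = 0"
    then have "\<forall>x\<in>{a..b}. ?f x = 0"
      using integral_eq_0_iff[OF cont _ nonneg] assms(1) by auto
    then have "{a<..<b} \<subseteq> {x. poly p x = 0}" by auto
    then have "finite {a<..<b}" using poly_roots_finite[OF assms(2)] finite_subset by blast
    then show False using assms(1) infinite_Ioo by blast
  qed
  with ge show ?thesis by simp
qed

text \<open>
  A polynomial of degree at most \<open>k\<close> with value \<open>c\<close> at \<open>a\<close> has the form \<open>c + (x - a) h\<close> with
  \<open>degree h \<le> k - 1\<close>. The moment conditions then say that \<open>h\<close> represents the functional
  \<open>\<psi> \<mapsto> \<integral> (g - c) \<psi>\<close> in the inner product with weight \<open>x - a\<close>.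
\<close>

lemma gauss_radau_ex1:
  fixes a b c :: real and g :: "real \<Rightarrow> real" and k :: nat
  assumes "a < b" "continuous_on {a..b} g" "1 \<le> k"
  shows "\<exists>!q. degree q \<le> k \<and>
      (\<forall>\<psi>. degree \<psi> \<le> k - 1 \<longrightarrow>
        integral {a..b} (\<lambda>x. poly q x * poly \<psi> x) = integral {a..b} (\<lambda>x. g x * poly \<psi> x)) \<and>
      poly q a = c"
proof -
  define B where "B = (\<lambda>p q. integral {a..b} (\<lambda>x. (x - a) * poly p x * poly q x))"
  define F where "F = (\<lambda>p. integral {a..b} (\<lambda>x. (g x - c) * poly p x))"
  have deg: "(\<forall>i\<ge>k. coeff \<psi> i = 0) \<longleftrightarrow> degree \<psi> \<le> k - 1" for \<psi> :: "real poly"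
  proof
    assume "\<forall>i\<ge>k. coeff \<psi> i = 0"
    then show "degree \<psi> \<le> k - 1" using assms(3) by (intro degree_le) auto
  next
    assume "degree \<psi> \<le> k - 1"
    then show "\<forall>i\<ge>k. coeff \<psi> i = 0" using assms(3) by (auto intro: coeff_eq_0)
  qed
  have int: "f integrable_on {a..b}" if "continuous_on {a..b} f" for f :: "real \<Rightarrow> real"
    using that by (rule integrable_continuous_interval)
  have "\<exists>h. (\<forall>i\<ge>k. coeff h i = 0) \<and> (\<forall>\<psi>. (\<forall>i\<ge>k. coeff \<psi> i = 0) \<longrightarrow> B h \<psi> = F \<psi>)"
  proof (rule poly_riesz)
    show "B p q = B q p" for p q by (simp add: B_def mult_ac)
    show "B (p + q) s = B p s + B q s" for p q s
      unfolding B_def by (subst integral_add[symmetric])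
        (auto intro!: int continuous_intros simp: algebra_simps)
    show "B (smult d p) s = d * B p s" for d p s
      unfolding B_def by (subst integral_mult_right[symmetric]) (simp add: mult_ac)
    show "0 < B p p" if "p \<noteq> 0" for p
      unfolding B_def by (rule weighted_square_integral_pos[OF assms(1) that])
    show "F (p + q) = F p + F q" for p q
      unfolding F_def by (subst integral_add[symmetric])
        (auto intro!: int continuous_intros assms(2) simp: algebra_simps)
    show "F (smult d p) = d * F p" for d p
      unfolding F_def by (subst integral_mult_right[symmetric]) (simp add: mult_ac)
  qed
  then obtain h where h: "degree h \<le> k - 1" "\<And>\<psi>. degree \<psi> \<le> k - 1 \<Longrightarrow> B h \<psi> = F \<psi>"
    unfolding deg by blast
  define q where "q = [:c:] + [:- a, 1:] * h"
  show ?thesis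
  proof (rule ex1I[of _ q], intro conjI allI impI)
    have "degree ([:- a, 1:] * h) \<le> k"
      using degree_mult_le[of "[:- a, 1:]" h] h(1) assms(3) by simp
    then show "degree q \<le> k" unfolding q_def by (intro degree_add_le) auto
    show "poly q a = c" by (simp add: q_def)
    fix \<psi> :: "real poly" assume d: "degree \<psi> \<le> k - 1"
    have "integral {a..b} (\<lambda>x. poly q x * poly \<psi> x)
        = integral {a..b} (\<lambda>x. (x - a) * poly h x * poly \<psi> x) + integral {a..b} (\<lambda>x. c * poly \<psi> x)"
      by (subst integral_add[symmetric])
        (auto intro!: int continuous_intros simp: q_def algebra_simps)
    also have "\<dots> = integral {a..b} (\<lambda>x. (g x - c) * poly \<psi> x) + integral {a..b} (\<lambda>x. c * poly \<psi> x)"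
      using h(2)[OF d] by (simp add: B_def F_def)
    also have "\<dots> = integral {a..b} (\<lambda>x. g x * poly \<psi> x)"
      by (subst integral_add[symmetric])
        (auto intro!: int continuous_intros assms(2) simp: algebra_simps)
    finally show "integral {a..b} (\<lambda>x. poly q x * poly \<psi> x) = integral {a..b} (\<lambda>x. g x * poly \<psi> x)" .
  next
    fix q'
    assume *: "degree q' \<le> k \<and>
      (\<forall>\<psi>. degree \<psi> \<le> k - 1 \<longrightarrow>
        integral {a..b} (\<lambda>x. poly q' x * poly \<psi> x) = integral {a..b} (\<lambda>x. g x * poly \<psi> x)) \<and>
      poly q' a = c"
    from * have "poly (q' - [:c:]) a = 0" by simp
    then obtain h' where h': "q' - [:c:] = [:- a, 1:] * h'" unfolding poly_eq_0_iff_dvd by (elim dvdE)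
    then have q': "q' = [:c:] + [:- a, 1:] * h'" by (simp add: algebra_simps)
    have dh': "degree h' \<le> k - 1"
    proof (cases "h' = 0")
      case False
      have "degree ([:- a, 1:] * h') \<le> k"
        unfolding h'[symmetric] using * by (intro degree_diff_le) auto
      moreover have "degree ([:- a, 1:] * h') = 1 + degree h'"
        using False by (subst degree_mult_eq) auto
      ultimately show ?thesis by simp
    qed simp
    have "B h' \<psi> = F \<psi>" if d: "degree \<psi> \<le> k - 1" for \<psi>
    proof -
      have "B h' \<psi> = integral {a..b} (\<lambda>x. poly q' x * poly \<psi> x) - integral {a..b} (\<lambda>x. c * poly \<psi> x)"
        unfolding B_def by (subst integral_diff[symmetric])
          (auto intro!: int continuous_intros simp: q' algebra_simps)
      also have "\<dots> = integral {a..b} (\<lambda>x. g x * poly \<psi> x) - integral {a..b} (\<lambda>x. c * poly \<psi> x)"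
        using * d by simp
      also have "\<dots> = F \<psi>"
        unfolding F_def by (subst integral_diff[symmetric])
          (auto intro!: int continuous_intros assms(2) simp: algebra_simps)
      finally show ?thesis .
    qed
    moreover have "degree (h' - h) \<le> k - 1" using dh' h(1) by (intro degree_diff_le)
    ultimately have "B h' (h' - h) - B h (h' - h) = 0" using h(2) by simp
    moreover have "B (h' - h) (h' - h) = B h' (h' - h) - B h (h' - h)"
      unfolding B_def by (subst integral_diff[symmetric])
        (auto intro!: int continuous_intros simp: algebra_simps)
    ultimately have "h' - h = 0"
      using weighted_square_integral_pos[OF assms(1), of "h' - h"] by (auto simp: B_def)
    then show "q' = q" by (simp add: q' q_def)
  qed
qed

section \<open>Uniqueness for the Lane--Emden equation\<close>

text \<open>At interior points the equation \<open>(s\<^sup>2 f)' = - s\<^sup>2 y\<close> is \<open>f' = - y - 2 f / s\<close>.\<close>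

lemma lane_emden_second_deriv:
  assumes "0 < s" "s < L"
    and "\<exists>D. ((\<lambda>s. s\<^sup>2 * f s) has_real_derivative D) (at s within {0..L}) \<and> 1 / s\<^sup>2 * D = - y"
  shows "(f has_real_derivative (- y - 2 / s * f s)) (at s)"
proof -
  from assms(3) obtain D where D: "((\<lambda>s. s\<^sup>2 * f s) has_real_derivative D) (at s within {0..L})"
    "1 / s\<^sup>2 * D = - y" by blast
  have "at s within {0..L} = at s" by (rule at_within_interior) (use assms in auto)
  with D have D': "((\<lambda>s. s\<^sup>2 * f s) has_real_derivative D) (at s)" by simp
  have "((\<lambda>t. (t\<^sup>2 * f t) / t\<^sup>2) has_real_derivative (D * s\<^sup>2 - (s\<^sup>2 * f s) * (2 * s)) / (s\<^sup>2 * s\<^sup>2)) (at s)"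
  proof (rule DERIV_divide[OF D'])
    show "((\<lambda>t. t\<^sup>2) has_real_derivative 2 * s) (at s)"
      by (auto intro!: derivative_eq_intros)
  qed (use assms(1) in simp)
  moreover have "(D * s\<^sup>2 - (s\<^sup>2 * f s) * (2 * s)) / (s\<^sup>2 * s\<^sup>2) = - y - 2 / s * f s"
    unfolding D(2)[symmetric] using assms(1) by (simp add: field_simps power2_eq_square)
  ultimately have "((\<lambda>t. (t\<^sup>2 * f t) / t\<^sup>2) has_real_derivative (- y - 2 / s * f s)) (at s)" by simp
  then show ?thesis
    by (rule has_field_derivative_transform_within_open[where S="{0<..}"]) (use assms in auto)
qed

lemma powr_lipschitz_on_Icc:
  fixes m M n :: real
  assumes "0 < m"
  obtains C where "0 \<le> C"
    "\<And>x y. x \<in> {m..M} \<Longrightarrow> y \<in> {m..M} \<Longrightarrow> \<bar>x powr n - y powr n\<bar> \<le> C * \<bar>x - y\<bar>"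
proof -
  have "compact ((\<lambda>t. n * t powr (n - 1)) ` {m..M})"
    using assms by (intro compact_continuous_image continuous_intros) auto
  then have "bounded ((\<lambda>t. n * t powr (n - 1)) ` {m..M})" by (rule compact_imp_bounded)
  then obtain C where C: "0 < C" "\<And>t. t \<in> {m..M} \<Longrightarrow> \<bar>n * t powr (n - 1)\<bar> \<le> C"
    unfolding bounded_pos by auto
  show ?thesis
  proof
    show "0 \<le> C" using C(1) by simp
    fix x y assume xy: "x \<in> {m..M}" "y \<in> {m..M}"
    have "norm (x powr n - y powr n) \<le> C * norm (x - y)"
    proof (rule field_differentiable_bound[where S="{m..M}" and f'="\<lambda>t. n * t powr (n - 1)"])
      fix t assume t: "t \<in> {m..M}"
      then show "((\<lambda>t. t powr n) has_field_derivative n * t powr (n - 1)) (at t within {m..M})"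
        using assms by (intro has_field_derivative_at_within[OF has_real_derivative_powr]) simp
      show "norm (n * t powr (n - 1)) \<le> C" unfolding real_norm_def by (rule C(2)[OF t])
    qed (use xy in simp_all)
    then show "\<bar>x powr n - y powr n\<bar> \<le> C * \<bar>x - y\<bar>" by simp
  qed
qed

text \<open>
  Uniqueness in spite of the singularity at \<open>0\<close>: for the difference \<open>d\<close> of two solutions, the energy
  \<open>d\<^sup>2 + d'\<^sup>2\<close> starts at \<open>0\<close> and grows at most exponentially, because the singular term \<open>- 2 d' / s\<close>
  of the second derivative contributes \<open>- 4 d'\<^sup>2 / s \<le> 0\<close> to the derivative of the energy.
\<close>

lemma lane_emden_on_unique:
  assumes "0 \<le> L" "lane_emden_on n L \<theta>" "lane_emden_on n L \<eta>"
  shows "\<theta> L = \<eta> L"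
proof (cases "L = 0")
  case True
  with assms show ?thesis by (simp add: lane_emden_on_def)
next
  case False
  then have L: "0 < L" using assms(1) by simp
  from assms(2) obtain f where f: "\<forall>x\<in>{0..L}. 0 < \<theta> x" "\<theta> 0 = 1" "continuous_on {0..L} f" "f 0 = 0"
    "\<forall>x\<in>{0..L}. (\<theta> has_real_derivative f x) (at x within {0..L})"
    "\<forall>x\<in>{0<..L}. \<exists>D. ((\<lambda>s. s\<^sup>2 * f s) has_real_derivative D) (at x within {0..L}) \<and>
         1 / x\<^sup>2 * D = - (\<theta> x powr n)"
    unfolding lane_emden_on_def by blast
  from assms(3) obtain g where g: "\<forall>x\<in>{0..L}. 0 < \<eta> x" "\<eta> 0 = 1" "continuous_on {0..L} g" "g 0 = 0"
    "\<forall>x\<in>{0..L}. (\<eta> has_real_derivative g x) (at x within {0..L})"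
    "\<forall>x\<in>{0<..L}. \<exists>D. ((\<lambda>s. s\<^sup>2 * g s) has_real_derivative D) (at x within {0..L}) \<and>
         1 / x\<^sup>2 * D = - (\<eta> x powr n)"
    unfolding lane_emden_on_def by blast
  have cont: "continuous_on {0..L} \<theta>" "continuous_on {0..L} \<eta>"
    using f(5) g(5) by (auto intro!: DERIV_continuous_on)
  \<comment> \<open>both solutions take values in a compact subset of \<open>(0, \<infinity>)\<close>, on which \<open>y powr n\<close> is Lipschitz\<close>
  define A where "A = \<theta> ` {0..L} \<union> \<eta> ` {0..L}"
  have A: "compact A" "A \<noteq> {}" "\<forall>y\<in>A. 0 < y"
    using cont L f(1) g(1) unfolding A_def by (auto intro!: compact_Un compact_continuous_image)
  obtain m where m: "m \<in> A" "\<And>y. y \<in> A \<Longrightarrow> m \<le> y" using compact_attains_inf[OF A(1,2)] by blast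
  obtain M where M: "\<And>y. y \<in> A \<Longrightarrow> y \<le> M" using compact_attains_sup[OF A(1,2)] by blast
  obtain C where C: "0 \<le> C"
    "\<And>x y. x \<in> {m..M} \<Longrightarrow> y \<in> {m..M} \<Longrightarrow> \<bar>x powr n - y powr n\<bar> \<le> C * \<bar>x - y\<bar>"
    using powr_lipschitz_on_Icc[of m M n] A(3) m(1) by blast
  define d where "d = (\<lambda>s. \<theta> s - \<eta> s)"
  define d' where "d' = (\<lambda>s. f s - g s)"
  define e where "e = (\<lambda>s. ((d s)\<^sup>2 + (d' s)\<^sup>2) * exp (- (C + 1) * s))"
  have "e L \<le> e 0"
  proof (rule DERIV_nonpos_imp_decreasing_open[of 0 L e])
    show "0 \<le> L" by (rule assms(1))
    show "continuous_on {0..L} e"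
      unfolding e_def d_def d'_def by (intro continuous_intros cont f(3) g(3))
    fix s assume s: "0 < s" "s < L"
    have int: "at s within {0..L} = at s" by (rule at_within_interior) (use s in auto)
    define \<Delta> where "\<Delta> = \<theta> s powr n - \<eta> s powr n"
    have "(\<theta> has_real_derivative f s) (at s)" "(\<eta> has_real_derivative g s) (at s)"
      using bspec[OF f(5), of s] bspec[OF g(5), of s] s int by simp_all
    then have dd: "(d has_real_derivative d' s) (at s)"
      unfolding d_def d'_def by (rule DERIV_diff)
    have sL: "s \<in> {0<..L}" using s by simp
    have "(d' has_real_derivative ((- (\<theta> s powr n) - 2 / s * f s) - (- (\<eta> s powr n) - 2 / s * g s))) (at s)"
      unfolding d'_def
      by (rule DERIV_diff[OF lane_emden_second_deriv[OF s bspec[OF f(6) sL]]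
            lane_emden_second_deriv[OF s bspec[OF g(6) sL]]])
    moreover define d'' where "d'' = - \<Delta> - 2 / s * d' s"
    ultimately have dd': "(d' has_real_derivative d'') (at s)"
      by (elim DERIV_cong) (simp add: d''_def \<Delta>_def d'_def algebra_simps diff_divide_distrib)
    let ?E = "2 * d s * d' s + 2 * d' s * d'' - (C + 1) * ((d s)\<^sup>2 + (d' s)\<^sup>2)"
    have de: "(e has_real_derivative ?E * exp (- (C + 1) * s)) (at s)"
    proof -
      have sq: "((\<lambda>s. (d s)\<^sup>2 + (d' s)\<^sup>2) has_real_derivative
          2 * d s * d' s + 2 * d' s * d'') (at s)"
      proof (rule DERIV_add)
        show "((\<lambda>s. (d s)\<^sup>2) has_real_derivative 2 * d s * d' s) (at s)"
          by (rule DERIV_cong[OF DERIV_power[OF dd]]) simp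
        show "((\<lambda>s. (d' s)\<^sup>2) has_real_derivative 2 * d' s * d'') (at s)"
          by (rule DERIV_cong[OF DERIV_power[OF dd']]) simp
      qed
      have ex: "((\<lambda>s. exp (- (C + 1) * s)) has_real_derivative
          exp (- (C + 1) * s) * (- (C + 1))) (at s)"
        by (rule DERIV_chain2[OF DERIV_exp DERIV_cmult_Id])
      have alg: "A * w + w * (- c) * q = (A - c * q) * w" for A w c q :: real
        by (simp add: algebra_simps)
      show ?thesis
        unfolding e_def by (rule DERIV_cong[OF DERIV_mult[OF sq ex]]) (rule alg)
    qed
    have abs_sq: "2 * (\<bar>d s\<bar> * \<bar>d' s\<bar>) \<le> (d s)\<^sup>2 + (d' s)\<^sup>2"
      using sum_squares_bound[of "\<bar>d s\<bar>" "\<bar>d' s\<bar>"] by simp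
    have "\<theta> s \<in> A" "\<eta> s \<in> A" using s by (auto simp: A_def)
    then have "\<bar>\<Delta>\<bar> \<le> C * \<bar>d s\<bar>" using C(2) m(2) M by (simp add: \<Delta>_def d_def)
    then have "\<bar>d' s\<bar> * \<bar>\<Delta>\<bar> \<le> \<bar>d' s\<bar> * (C * \<bar>d s\<bar>)" by (intro mult_left_mono) auto
    then have "- 2 * (d' s * \<Delta>) \<le> C * (2 * (\<bar>d s\<bar> * \<bar>d' s\<bar>))"
      using abs_ge_minus_self[of "d' s * \<Delta>"] by (simp add: abs_mult mult_ac)
    also have "\<dots> \<le> C * ((d s)\<^sup>2 + (d' s)\<^sup>2)" by (rule mult_left_mono[OF abs_sq C(1)])
    finally have 1: "- 2 * (d' s * \<Delta>) \<le> C * ((d s)\<^sup>2 + (d' s)\<^sup>2)" .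
    have 2: "2 * (d s * d' s) \<le> (d s)\<^sup>2 + (d' s)\<^sup>2"
      using sum_squares_bound[of "d s" "d' s"] by simp
    have 3: "0 \<le> 4 / s * (d' s)\<^sup>2" using s by simp
    have "?E = 2 * (d s * d' s) + - 2 * (d' s * \<Delta>) - 4 / s * (d' s)\<^sup>2
        - C * ((d s)\<^sup>2 + (d' s)\<^sup>2) - ((d s)\<^sup>2 + (d' s)\<^sup>2)"
      by (simp add: d''_def algebra_simps power2_eq_square)
    with 1 2 3 have "?E \<le> 0" by linarith
    then have "?E * exp (- (C + 1) * s) \<le> 0" by (simp add: mult_nonpos_nonneg)
    with de show "\<exists>y. (e has_real_derivative y) (at s) \<and> y \<le> 0" by blast
  qed
  moreover have "e 0 = 0" using f(2,4) g(2,4) by (simp add: e_def d_def d'_def)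
  ultimately have "((d L)\<^sup>2 + (d' L)\<^sup>2) * exp (- (C + 1) * L) \<le> 0" by (simp add: e_def)
  then have "(d L)\<^sup>2 + (d' L)\<^sup>2 \<le> 0" by (simp add: mult_le_0_iff not_le[symmetric])
  then have "(d L)\<^sup>2 \<le> 0" using zero_le_power2[of "d' L"] by linarith
  then show ?thesis by (simp add: d_def)
qed

lemma lane_emden_eq:
  assumes "0 \<le> L" "lane_emden_on n L \<theta>"
  shows "lane_emden n L = \<theta> L"
  unfolding lane_emden_def
proof (rule the_equality)
  show "\<exists>\<eta>. lane_emden_on n L \<eta> \<and> \<theta> L = \<eta> L" using assms(2) by blast
  show "y = \<theta> L" if "\<exists>\<eta>. lane_emden_on n L \<eta> \<and> y = \<eta> L" for y
    using that lane_emden_on_unique[OF assms(1) _ assms(2)] by blast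
qed

section \<open>Polytropic equilibria solve the Lane--Emden equation\<close>

text \<open>
  Restriction to \<open>[0, x / \<alpha>]\<close> is what the pointwise definition of \<open>lane_emden\<close> asks for. The interval
  is degenerate for \<open>x = 0\<close>, where the derivative conditions hold trivially.
\<close>

lemma polytropic_equilibrium_imp_lane_emden_on:
  fixes R \<gamma> G \<kappa> x :: real and \<rho> :: "real \<Rightarrow> real"
  defines "\<alpha> \<equiv> sqrt (\<gamma> / (\<gamma> - 1) * \<kappa> * \<rho> 0 powr (\<gamma> - 2) / (4 * pi * G))"
  assumes "1 < \<gamma>" "0 < G" "0 < \<kappa>" "polytropic_equilibrium R \<gamma> G \<kappa> \<rho>" "x \<in> {0..R}"
  shows "lane_emden_on (1 / (\<gamma> - 1)) (x / \<alpha>) (\<lambda>\<xi>. (\<rho> (\<alpha> * \<xi>) / \<rho> 0) powr (\<gamma> - 1))"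
proof -
  from assms(5) obtain \<rho>' \<rho>'' where pos: "\<And>x. x\<in>{0..R} \<Longrightarrow> 0 < \<rho> x"
    and d1: "\<And>x. x\<in>{0..R} \<Longrightarrow> (\<rho> has_real_derivative \<rho>' x) (at x within {0..R})"
    and d2: "\<And>x. x\<in>{0..R} \<Longrightarrow> (\<rho>' has_real_derivative \<rho>'' x) (at x within {0..R})"
    and z: "\<rho>' 0 = 0"
    and ode: "\<And>x. x\<in>{0<..R} \<Longrightarrow> \<exists>D.
         ((\<lambda>s. s\<^sup>2 / \<rho> s * (\<kappa> * \<gamma> * \<rho> s powr (\<gamma> - 1) * \<rho>' s)) has_real_derivative D)
           (at x within {0..R}) \<and> 1 / x\<^sup>2 * D = - (4 * pi * G * \<rho> x)"
    unfolding polytropic_equilibrium_def by blast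
  have R: "0 \<le> R" and \<rho>0: "0 < \<rho> 0" using assms(6) pos by auto
  have \<alpha>2: "\<alpha>\<^sup>2 = \<gamma> / (\<gamma> - 1) * \<kappa> * \<rho> 0 powr (\<gamma> - 2) / (4 * pi * G)"
    unfolding \<alpha>_def using assms(2-4) by (intro real_sqrt_pow2) simp
  have \<alpha>: "0 < \<alpha>" unfolding \<alpha>_def using assms(2-4) \<rho>0 by simp
  define L where "L = x / \<alpha>"
  have sub: "\<alpha> * \<xi> \<in> {0..R}" if "\<xi> \<in> {0..L}" for \<xi>
  proof -
    have "\<alpha> * \<xi> \<le> \<alpha> * L" using that \<alpha> by (intro mult_left_mono) auto
    then show ?thesis using that \<alpha> assms(6) by (auto simp: L_def)
  qed
  have scale: "((\<lambda>s. h (\<alpha> * s)) has_real_derivative D * \<alpha>) (at \<xi> within {0..L})"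
    if "\<xi> \<in> {0..L}" "(h has_real_derivative D) (at (\<alpha> * \<xi>) within {0..R})" for h D \<xi>
  proof -
    have "(h has_real_derivative D) (at (\<alpha> * \<xi>) within (\<lambda>s. \<alpha> * s) ` {0..L})"
      by (rule DERIV_subset[OF that(2)]) (use sub in auto)
    moreover have "((\<lambda>s. \<alpha> * s) has_real_derivative \<alpha>) (at \<xi> within {0..L})"
      by (auto intro!: derivative_eq_intros)
    ultimately show ?thesis using DERIV_image_chain[of h D "\<lambda>s. \<alpha> * s" \<xi> "{0..L}" \<alpha>] by (simp add: o_def)
  qed
  define \<theta>' where "\<theta>' = (\<lambda>\<xi>. (\<gamma> - 1) * (\<rho> (\<alpha> * \<xi>) / \<rho> 0) powr (\<gamma> - 2) * (\<rho>' (\<alpha> * \<xi>) * \<alpha> / \<rho> 0))"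
  show ?thesis
    unfolding lane_emden_on_def L_def[symmetric]
  proof (intro conjI ballI exI[of _ \<theta>'])
    show "0 < (\<rho> (\<alpha> * \<xi>) / \<rho> 0) powr (\<gamma> - 1)" if "\<xi> \<in> {0..L}" for \<xi>
      using pos[OF sub[OF that]] \<rho>0 by simp
    show "(\<rho> (\<alpha> * 0) / \<rho> 0) powr (\<gamma> - 1) = 1" using \<rho>0 by simp
    show "\<theta>' 0 = 0" by (simp add: \<theta>'_def z)
    have "continuous_on {0..L} (\<lambda>\<xi>. \<rho> (\<alpha> * \<xi>))" "continuous_on {0..L} (\<lambda>\<xi>. \<rho>' (\<alpha> * \<xi>))"
      by (rule DERIV_continuous_on, rule scale, assumption, rule d1 d2, rule sub, assumption)+
    then show "continuous_on {0..L} \<theta>'"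
      unfolding \<theta>'_def using pos[OF sub] \<rho>0 by (intro continuous_intros) force+
    show "((\<lambda>\<xi>. (\<rho> (\<alpha> * \<xi>) / \<rho> 0) powr (\<gamma> - 1)) has_real_derivative \<theta>' \<xi>) (at \<xi> within {0..L})"
      if \<xi>: "\<xi> \<in> {0..L}" for \<xi>
    proof -
      have "((\<lambda>\<xi>. \<rho> (\<alpha> * \<xi>) / \<rho> 0) has_real_derivative \<rho>' (\<alpha> * \<xi>) * \<alpha> / \<rho> 0) (at \<xi> within {0..L})"
        by (rule DERIV_cdivide[OF scale[OF \<xi> d1[OF sub[OF \<xi>]]]])
      moreover have "((\<lambda>y. y powr (\<gamma> - 1)) has_real_derivative
          (\<gamma> - 1) * (\<rho> (\<alpha> * \<xi>) / \<rho> 0) powr (\<gamma> - 1 - 1)) (at (\<rho> (\<alpha> * \<xi>) / \<rho> 0))"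
        using pos[OF sub[OF \<xi>]] \<rho>0 by (intro has_real_derivative_powr) simp
      ultimately have "((\<lambda>\<xi>. (\<rho> (\<alpha> * \<xi>) / \<rho> 0) powr (\<gamma> - 1)) has_real_derivative
          (\<gamma> - 1) * (\<rho> (\<alpha> * \<xi>) / \<rho> 0) powr (\<gamma> - 1 - 1) * (\<rho>' (\<alpha> * \<xi>) * \<alpha> / \<rho> 0))
          (at \<xi> within {0..L})"
        by (rule DERIV_chain2[rotated])
      then show ?thesis by (simp add: \<theta>'_def)
    qed
    fix \<xi> assume \<xi>: "\<xi> \<in> {0<..L}"
    then have \<xi>': "\<xi> \<in> {0..L}" and \<xi>0: "0 < \<xi>" by auto
    have "\<alpha> * \<xi> \<in> {0<..R}" using sub[OF \<xi>'] \<alpha> \<xi>0 by simp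
    from ode[OF this] obtain D where
      D: "((\<lambda>s. s\<^sup>2 / \<rho> s * (\<kappa> * \<gamma> * \<rho> s powr (\<gamma> - 1) * \<rho>' s)) has_real_derivative D)
           (at (\<alpha> * \<xi>) within {0..R})" "1 / (\<alpha> * \<xi>)\<^sup>2 * D = - (4 * pi * G * \<rho> (\<alpha> * \<xi>))"
      by blast
    \<comment> \<open>\<open>c\<close> converts the differentiated term of the equilibrium equation at \<open>\<alpha> s\<close> into \<open>s\<^sup>2 \<theta>' s\<close>\<close>
    define c where "c = (\<gamma> - 1) * \<rho> 0 powr (1 - \<gamma>) / (\<alpha> * \<kappa> * \<gamma>)"
    have eq: "c * ((\<alpha> * s)\<^sup>2 / \<rho> (\<alpha> * s) * (\<kappa> * \<gamma> * \<rho> (\<alpha> * s) powr (\<gamma> - 1) * \<rho>' (\<alpha> * s))) = s\<^sup>2 * \<theta>' s"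
      if s: "s \<in> {0..L}" for s
    proof -
      have p: "0 < \<rho> (\<alpha> * s)" by (rule pos[OF sub[OF s]])
      have e1: "\<rho> (\<alpha> * s) powr (\<gamma> - 1) = \<rho> (\<alpha> * s) powr (\<gamma> - 2) * \<rho> (\<alpha> * s)"
        using p powr_add[of "\<rho> (\<alpha> * s)" "\<gamma> - 2" 1] by simp
      have e2: "\<rho> 0 powr (1 - \<gamma>) = 1 / (\<rho> 0 powr (\<gamma> - 2) * \<rho> 0)"
        using \<rho>0 powr_add[of "\<rho> 0" "\<gamma> - 2" 1] powr_minus_divide[of "\<rho> 0" "\<gamma> - 1"] by simp
      define X where "X = \<rho> (\<alpha> * s) powr (\<gamma> - 2)"
      have "s\<^sup>2 * \<theta>' s = s\<^sup>2 * (\<gamma> - 1) * \<rho>' (\<alpha> * s) * \<alpha> * (X * \<rho> 0 powr (1 - \<gamma>))"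
        using p \<rho>0 by (simp add: \<theta>'_def X_def powr_divide e2)
      also have "\<dots> = c * (\<alpha> * \<kappa> * \<gamma>) * (\<alpha> * s\<^sup>2 * X * \<rho>' (\<alpha> * s))"
        unfolding c_def using \<alpha> assms(2,4) by simp
      also have "\<dots> = c * ((\<alpha> * s)\<^sup>2 / \<rho> (\<alpha> * s) * (\<kappa> * \<gamma> * \<rho> (\<alpha> * s) powr (\<gamma> - 1) * \<rho>' (\<alpha> * s)))"
        unfolding e1 X_def[symmetric] using p by (simp add: power2_eq_square)
      finally show ?thesis by simp
    qed
    have "((\<lambda>s. c * ((\<alpha> * s)\<^sup>2 / \<rho> (\<alpha> * s) * (\<kappa> * \<gamma> * \<rho> (\<alpha> * s) powr (\<gamma> - 1) * \<rho>' (\<alpha> * s))))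
        has_real_derivative c * (D * \<alpha>)) (at \<xi> within {0..L})"
      by (rule DERIV_cmult[OF scale[OF \<xi>' D(1)]])
    then have "((\<lambda>s. s\<^sup>2 * \<theta>' s) has_real_derivative c * (D * \<alpha>)) (at \<xi> within {0..L})"
      by (rule has_field_derivative_transform_within[OF _ zero_less_one \<xi>']) (use eq in auto)
    moreover have "1 / \<xi>\<^sup>2 * (c * (D * \<alpha>)) = - (((\<rho> (\<alpha> * \<xi>) / \<rho> 0) powr (\<gamma> - 1)) powr (1 / (\<gamma> - 1)))"
    proof -
      have p: "0 < \<rho> (\<alpha> * \<xi>)" by (rule pos[OF sub[OF \<xi>']])
      have "1 / \<xi>\<^sup>2 * (c * (D * \<alpha>)) = c * \<alpha> * \<alpha>\<^sup>2 * (1 / (\<alpha> * \<xi>)\<^sup>2 * D)"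
        using \<alpha> \<xi>0 by (simp add: field_simps power2_eq_square)
      also have "\<dots> = - (c * \<alpha> * (4 * pi * G * \<alpha>\<^sup>2) * \<rho> (\<alpha> * \<xi>))" unfolding D(2) by simp
      also have "4 * pi * G * \<alpha>\<^sup>2 = \<gamma> / (\<gamma> - 1) * \<kappa> * \<rho> 0 powr (\<gamma> - 2)"
        unfolding \<alpha>2 using assms(2,3) by simp
      also have "c * \<alpha> * (\<gamma> / (\<gamma> - 1) * \<kappa> * \<rho> 0 powr (\<gamma> - 2)) = \<rho> 0 powr (1 - \<gamma>) * \<rho> 0 powr (\<gamma> - 2)"
        unfolding c_def using \<alpha> assms(2,4) by (simp add: divide_simps)
      also have "\<dots> = 1 / \<rho> 0" using \<rho>0 powr_minus_divide[of "\<rho> 0" 1] by (simp flip: powr_add)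
      also have "- (1 / \<rho> 0 * \<rho> (\<alpha> * \<xi>)) = - (((\<rho> (\<alpha> * \<xi>) / \<rho> 0) powr (\<gamma> - 1)) powr (1 / (\<gamma> - 1)))"
        using p \<rho>0 assms(2) by (simp add: powr_powr)
      finally show ?thesis .
    qed
    ultimately show "\<exists>D. ((\<lambda>s. s\<^sup>2 * \<theta>' s) has_real_derivative D) (at \<xi> within {0..L}) \<and>
       1 / \<xi>\<^sup>2 * D = - (((\<rho> (\<alpha> * \<xi>) / \<rho> 0) powr (\<gamma> - 1)) powr (1 / (\<gamma> - 1)))"
      by blast
  qed
qed

section \<open>Properties of the scheme operators\<close>

context euler_poisson_dg
begin

lemma mesh_mono: "i \<le> j \<Longrightarrow> j \<le> N \<Longrightarrow> r i \<le> r j"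
proof (induction j rule: dec_induct)
  case (step n)
  then show ?case using mesh_less[of n] by simp
qed simp

lemma mesh_in_domain: "j \<le> N \<Longrightarrow> r j \<in> {0..R}"
  using mesh_mono[of 0 j] mesh_mono[of j N] mesh_left mesh_right by simp

lemma cell_less: "j \<in> {1..N} \<Longrightarrow> r (j - 1) < r j"
  using mesh_less[of "j - 1"] by (cases j) simp_all

lemma cell_subset: "j \<in> {1..N} \<Longrightarrow> cell j \<subseteq> {0..R}"
  using mesh_in_domain[of "j - 1"] mesh_in_domain[of j] by (auto simp: cell_def)

text \<open>
  The projection only sees \<open>g\<close> on \<open>[0, R]\<close>: the limits from the right are taken at left endpoints of
  cells. No regularity of \<open>g\<close> is needed.
\<close>

lemma gauss_radau_cong:
  assumes "\<And>x. x \<in> {0..R} \<Longrightarrow> g x = h x"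
  shows "gauss_radau g = gauss_radau h"
proof
  fix j
  show "gauss_radau g j = gauss_radau h j"
  proof (cases "j \<in> {1..N}")
    case True
    have "eventually (\<lambda>x. x \<in> {r (j - 1)<..<r j}) (at_right (r (j - 1)))"
      by (rule eventually_at_right_real[OF cell_less[OF True]])
    then have "eventually (\<lambda>x. g x = h x) (at_right (r (j - 1)))"
      by (rule eventually_mono) (use assms cell_subset[OF True] in \<open>auto simp: cell_def\<close>)
    then have "Lim (at_right (r (j - 1))) g = Lim (at_right (r (j - 1))) h"
      unfolding Topological_Spaces.Lim_def by (simp only: tendsto_cong)
    moreover have "integral (cell j) (\<lambda>x. g x * poly \<psi> x) = integral (cell j) (\<lambda>x. h x * poly \<psi> x)" for \<psi>
      by (rule integral_cong) (use assms cell_subset[OF True] in auto)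
    ultimately show ?thesis by (simp only: gauss_radau_def)
  next
    case False
    then show ?thesis by (simp only: gauss_radau_def if_False)
  qed
qed

lemma gauss_radau3_cong:
  assumes "\<And>x. x \<in> {0..R} \<Longrightarrow> g x = h x"
  shows "gauss_radau3 g = gauss_radau3 h"
proof -
  have "gauss_radau (\<lambda>x. g x $ i) = gauss_radau (\<lambda>x. h x $ i)" for i
    by (rule gauss_radau_cong) (simp add: assms)
  then show ?thesis by (simp add: gauss_radau3_def fun_eq_iff)
qed

text \<open>For continuous \<open>g\<close>, the one-sided limit in the definition is the value of \<open>g\<close>.\<close>

lemma gauss_radau_spec:
  assumes "continuous_on {0..R} g" "j \<in> {1..N}"
  defines "radau \<equiv> \<lambda>q. degree q \<le> k \<and>
      (\<forall>\<psi>. degree \<psi> \<le> k - 1 \<longrightarrow>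
        integral (cell j) (\<lambda>x. poly q x * poly \<psi> x) = integral (cell j) (\<lambda>x. g x * poly \<psi> x)) \<and>
      poly q (r (j - 1)) = g (r (j - 1))"
  shows "radau (gauss_radau g j)" and "radau q \<Longrightarrow> gauss_radau g j = q"
proof -
  have cont: "continuous_on {r (j - 1)..r j} g"
    by (rule continuous_on_subset[OF assms(1) cell_subset[OF assms(2), unfolded cell_def]])
  have "(g \<longlongrightarrow> g (r (j - 1))) (at_right (r (j - 1)))"
    by (rule continuous_on_Icc_at_rightD[OF cont cell_less[OF assms(2)]])
  then have "Lim (at_right (r (j - 1))) g = g (r (j - 1))"
    by (intro tendsto_Lim) simp_all
  then have eq: "gauss_radau g j = (THE q. radau q)"
    using assms(2) by (simp add: gauss_radau_def radau_def)
  have ex1: "\<exists>!q. radau q"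
    unfolding radau_def cell_def by (rule gauss_radau_ex1[OF cell_less[OF assms(2)] cont k_pos])
  show "radau (gauss_radau g j)" unfolding eq by (rule theI'[OF ex1])
  show "gauss_radau g j = q" if "radau q" unfolding eq by (rule the1_equality[OF ex1 that])
qed

lemma gauss_radau_zero:
  assumes "\<And>x. x \<in> {0..R} \<Longrightarrow> g x = 0"
  shows "gauss_radau g j = 0"
proof (cases "j \<in> {1..N}")
  case True
  have "gauss_radau (\<lambda>x. 0) j = 0"
    by (rule gauss_radau_spec(2)[OF _ True]) simp_all
  then show ?thesis using gauss_radau_cong[of g "\<lambda>x. 0"] assms by simp
next
  case False
  then show ?thesis by (simp only: gauss_radau_def if_False)
qed

lemma gauss_radau_in_dg_space:
  assumes "continuous_on {0..R} g"
  shows "gauss_radau g \<in> dg_space"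
  using gauss_radau_spec(1)[OF assms] by (auto simp: dg_space_def gauss_radau_def[of g])

text \<open>
  For equal states at rest the contact speed is \<open>0\<close>, and the outer waves have the speeds \<open>- c\<close> and
  \<open>c\<close> with \<open>c > 0\<close>; the second branch applies, and its intermediate state is the given one.
\<close>

lemma hllc_rest_state:
  assumes "0 < s $ 1" "s $ 2 = 0" "0 < pressure s"
  shows "hllc s s = vector [0, pressure s, 0]"
proof -
  have v: "velocity s = 0" using assms(2) by (simp add: velocity_def)
  have c: "0 < sound_speed s" using assms gamma_gt_1 by (simp add: sound_speed_def)
  have "hllc_star s (- sound_speed s) 0 = s"
    using assms(1,2) c by (simp add: hllc_star_def v vec_eq_iff forall_3)
  then have "hllc s s = flux s"
    using c by (simp add: hllc_def Let_def v)
  then show ?thesis by (simp add: flux_def v assms(2))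
qed

lemma flux_rest_state: "s $ 2 = 0 \<Longrightarrow> flux s = vector [0, pressure s, 0]"
  by (simp add: flux_def velocity_def)

text \<open>
  The condition on the momentum is used at the center, where the exterior state is obtained by
  reflection.
\<close>

lemma traces_of_equilibrium:
  assumes "ue u = u" "ud u (r j) $ 2 = 0"
  shows "ustar_minus u j = ud u (r j)" "ustar_plus u j = ud u (r j)"
proof -
  have "uf u i = 0" for i using assms(1) by (simp add: uf_def)
  then have "pw_val (uf u) i x = 0" for i x by (simp add: pw_val_def vec_eq_iff)
  then have tr: "trace_left u j = ud u (r j)" "trace_right u j = ud u (r j)"
    by (simp_all add: trace_left_def trace_right_def)
  have "reflect s = s" if "s $ 2 = 0" for s
    using that by (simp add: reflect_def vec_eq_iff forall_3)
  with tr assms(2) show "ustar_minus u j = ud u (r j)" "ustar_plus u j = ud u (r j)"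
    by (auto simp: ustar_minus_def ustar_plus_def)
qed

text \<open>
  The cancellation behind the well-balanced property, for any state \<open>u\<close> at rest that is the projection
  of its own recovered equilibrium.
\<close>

lemma dg_rhs_equilibrium:
  assumes ue: "ue u = u"
    and mom: "\<And>i. u i $ 2 = 0"
    and rest: "\<And>x. x \<in> {0..R} \<Longrightarrow> ud u x $ 2 = 0"
    and pos: "\<And>x. x \<in> {0..R} \<Longrightarrow> 0 < ud u x $ 1" "\<And>x. x \<in> {0..R} \<Longrightarrow> 0 < pressure (ud u x)"
    and press: "\<And>x. x \<in> {0..R} \<Longrightarrow> pressure (ud u x) = pd u x"
    and j: "j \<in> {1..N}"
  shows "dg_rhs j u v = 0"
proof -
  have num: "num_flux u i = vector [0, pd u (r i), 0]" if "i \<le> N" for i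
    using mesh_in_domain[OF that] rest pos press
    by (simp add: num_flux_def traces_of_equilibrium[OF ue] hllc_rest_state)
  have mom': "pw_val u i x $ 2 = 0" for i x by (simp add: pw_val_def mom)
  have num_idx: "j \<le> N" "j - 1 \<le> N" using j by auto
  have "flux_op j u v =
    - ((r j)\<^sup>2 * pd u (r j) * pw_val v j (r j) $ 2)
    + (r (j - 1))\<^sup>2 * pd u (r (j - 1)) * pw_val v j (r (j - 1)) $ 2
    + integral (cell j) (\<lambda>x. pressure (pw_val u j x) * pw_deriv v j x $ 2 * x\<^sup>2)"
    using num[of j] num[of "j - 1"] num_idx
    by (simp add: flux_op_def flux_rest_state mom' inner_vec_def sum_3 mult.assoc)
  moreover have "source3 j u v = 0" by (simp add: source3_def mom')
  ultimately show ?thesis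
    by (simp add: dg_rhs_def source2_wb_def source2_cor_def ue)
qed

section \<open>Recovery of the exact equilibrium\<close>

lemma continuous_on_equilibrium:
  fixes i :: 3
  assumes eq: "polytropic_equilibrium R \<gamma> G \<kappa> \<rho>"
    and u_ex: "\<And>x. x \<in> {0..R} \<Longrightarrow> u_ex x = vector [\<rho> x, 0, \<kappa> / (\<gamma> - 1) * \<rho> x powr \<gamma>]"
  shows "continuous_on {0..R} (\<lambda>x. u_ex x $ i)"
proof -
  have \<rho>: "\<And>x. x \<in> {0..R} \<Longrightarrow> 0 < \<rho> x" "continuous_on {0..R} \<rho>"
    using eq unfolding polytropic_equilibrium_def by (blast, blast intro: DERIV_continuous_on)
  have "continuous_on {0..R} (\<lambda>x. vector [\<rho> x, 0, \<kappa> / (\<gamma> - 1) * \<rho> x powr \<gamma>] $ i)"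
  proof -
    have "continuous_on {0..R} (\<lambda>x. \<kappa> / (\<gamma> - 1) * \<rho> x powr \<gamma>)"
      by (intro continuous_intros \<rho>(2)) (use \<rho>(1) in force)
    with \<rho>(2) show ?thesis using exhaust_3[of i] by (elim disjE) simp_all
  qed
  then show ?thesis by (rule continuous_on_eq) (simp add: u_ex)
qed

text \<open>The recovery from the projected equilibrium reproduces the equilibrium exactly.\<close>

lemma equilibrium_recovery:
  assumes \<kappa>: "0 < \<kappa>" and eq: "polytropic_equilibrium R \<gamma> G \<kappa> \<rho>"
    and u_ex: "\<And>x. x \<in> {0..R} \<Longrightarrow> u_ex x = vector [\<rho> x, 0, \<kappa> / (\<gamma> - 1) * \<rho> x powr \<gamma>]"
    and x: "x \<in> {0..R}"
  shows "ud (gauss_radau3 u_ex) x = u_ex x"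
    and "pd (gauss_radau3 u_ex) x = \<kappa> * \<rho> x powr \<gamma>"
proof -
  define u where "u = gauss_radau3 u_ex"
  have zero: "0 \<in> {0..R}" using x by simp
  have \<rho>: "0 < \<rho> x" "0 < \<rho> 0" using eq x zero unfolding polytropic_equilibrium_def by blast+
  \<comment> \<open>the projection interpolates at the left endpoint \<open>r 0 = 0\<close> of the first cell\<close>
  have "poly (gauss_radau (\<lambda>x. u_ex x $ i) 1) (r (1 - 1)) = u_ex (r (1 - 1)) $ i" for i
    using gauss_radau_spec(1)[OF continuous_on_equilibrium[OF eq u_ex], of 1] N_pos by simp
  then have "pw_val u 1 0 = u_ex 0"
    by (simp add: u_def pw_val_def gauss_radau3_def mesh_left vec_eq_iff)
  then have rho0: "rho0 u = \<rho> 0" and p0: "p0 u = \<kappa> * \<rho> 0 powr \<gamma>"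
    using gamma_gt_1 by (simp_all add: rho0_def p0_def u_ex[OF zero] pressure_def velocity_def)
  have kappa0: "kappa0 u = \<kappa>" using \<rho>(2) by (simp add: kappa0_def rho0 p0)
  have alpha: "alpha u = sqrt (\<gamma> / (\<gamma> - 1) * \<kappa> * \<rho> 0 powr (\<gamma> - 2) / (4 * pi * G))"
    by (simp add: alpha_def kappa0 rho0)
  have alpha_pos: "0 < alpha u" unfolding alpha using \<kappa> \<rho>(2) gamma_gt_1 G_pos by simp
  have "lane_emden_on (1 / (\<gamma> - 1)) (x / alpha u)
      (\<lambda>\<xi>. (\<rho> (alpha u * \<xi>) / \<rho> 0) powr (\<gamma> - 1))"
    unfolding alpha by (rule polytropic_equilibrium_imp_lane_emden_on[OF gamma_gt_1 G_pos \<kappa> eq x])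
  then have "lane_emden (1 / (\<gamma> - 1)) (x / alpha u)
      = (\<rho> (alpha u * (x / alpha u)) / \<rho> 0) powr (\<gamma> - 1)"
    by (rule lane_emden_eq[rotated]) (use x alpha_pos in simp)
  then have \<theta>: "lane_emden (1 / (\<gamma> - 1)) (x / alpha u) = (\<rho> x / \<rho> 0) powr (\<gamma> - 1)"
    using alpha_pos by simp
  have "ud u x = vector [\<rho> x, 0, \<kappa> / (\<gamma> - 1) * \<rho> x powr \<gamma>]"
    using \<rho> gamma_gt_1
    by (simp add: ud_def Let_def \<theta> rho0 kappa0 powr_powr powr_divide vec_eq_iff forall_3)
  then show "ud (gauss_radau3 u_ex) x = u_ex x" "pd (gauss_radau3 u_ex) x = \<kappa> * \<rho> x powr \<gamma>"
    by (simp_all add: u_ex[OF x] pd_def kappa0 flip: u_def)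
qed

end

theorem proposition3p2:
  fixes R :: real and N :: nat and r :: "nat \<Rightarrow> real" and k :: nat and \<gamma> G \<kappa> :: real
    and \<rho> :: "real \<Rightarrow> real" and u_ex :: "real \<Rightarrow> state" and u_h0 :: pw_poly3
  assumes "euler_poisson_dg R N r k \<gamma> G"
    and "0 < \<kappa>"
    and "polytropic_equilibrium R \<gamma> G \<kappa> \<rho>"
    and "\<forall>x\<in>{0..R}. u_ex x = vector [\<rho> x, 0, \<kappa> / (\<gamma> - 1) * \<rho> x powr \<gamma>]"
    and "u_h0 = euler_poisson_dg.gauss_radau3 N r k u_ex"
    and "euler_poisson_dg.positive_density N r u_h0"
    and "euler_poisson_dg.recovery_well_defined R \<gamma> G u_h0"
  shows "(\<forall>j\<in>{1..N}. \<forall>v\<in>euler_poisson_dg.dg_space3 N k.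
            euler_poisson_dg.dg_rhs N r k \<gamma> G j u_h0 v = 0) \<and>
         euler_poisson_dg.dg_solution R N r k \<gamma> G u_ex (\<lambda>t. u_h0)"
proof -
  interpret euler_poisson_dg R N r k \<gamma> G by (rule assms(1))
  have u_ex: "u_ex x = vector [\<rho> x, 0, \<kappa> / (\<gamma> - 1) * \<rho> x powr \<gamma>]" if "x \<in> {0..R}" for x
    using assms(4) that by blast
  have \<rho>: "0 < \<rho> x" if "x \<in> {0..R}" for x
    using assms(3) that unfolding polytropic_equilibrium_def by blast
  have ud: "ud u_h0 x = u_ex x" and pd: "pd u_h0 x = \<kappa> * \<rho> x powr \<gamma>" if "x \<in> {0..R}" for x
    unfolding assms(5) by (rule equilibrium_recovery[OF assms(2,3) u_ex that]; assumption)+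
  have ue: "ue u_h0 = u_h0"
    unfolding ue_def by (subst (2) assms(5)) (rule gauss_radau3_cong[OF ud])
  have mom: "u_h0 i $ 2 = 0" for i
  proof -
    have "gauss_radau (\<lambda>x. u_ex x $ 2) i = 0" by (rule gauss_radau_zero) (simp add: u_ex)
    then show ?thesis by (simp add: assms(5) gauss_radau3_def)
  qed
  have rest: "ud u_h0 x $ 2 = 0" "0 < ud u_h0 x $ 1" "0 < pressure (ud u_h0 x)"
      "pressure (ud u_h0 x) = pd u_h0 x" if "x \<in> {0..R}" for x
    using \<rho>[OF that] assms(2) gamma_gt_1
    by (simp_all add: ud[OF that] pd[OF that] u_ex[OF that] pressure_def velocity_def)
  have rhs: "dg_rhs j u_h0 v = 0" if "j \<in> {1..N}" for j v
    by (rule dg_rhs_equilibrium[OF ue mom rest that])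
  have space: "u_h0 \<in> dg_space3"
    using gauss_radau_in_dg_space[OF continuous_on_equilibrium[OF assms(3) u_ex]]
    by (simp add: assms(5) dg_space3_def pw_comp_def gauss_radau3_def)
  have "admissible u_h0"
    using assms(6,7) rest mesh_in_domain
    by (simp add: admissible_def ue traces_of_equilibrium)
  with rhs space assms(5) show ?thesis by (simp add: dg_solution_def)
qed

end
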